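(* Let $f,\mathcal{U},\ell$ satisfy standing assumptions (A) and (B) of the context, and let the stopping function $c_{\text{stop}}:\mathbb{R}^{n_\varepsilon}\times\mathbb{R}^n\to\mathbb{R}_{\geq 0}$ satisfy assumption (C) of the context. For any $\varepsilon\in\mathbb{R}^{n_\varepsilon}$, $\Delta>0$ and $x\in\{z\in\mathbb{R}^n:\sigma(z)\leq\Delta\}$, $$V_\varepsilon(x)\leq V_\infty(x)\leq V_\varepsilon(x)+v_\varepsilon(x),$$ where $v_\varepsilon(x):=\overline{\alpha}_V\circ\alpha_W^{-1}(c_{\text{stop}}(\varepsilon,x))$ and $V_\varepsilon(x)$ is the value returned by value iteration terminated by the stopping criterion, as defined in the context. Moreover, when item (ii) of (C) holds with $L=\infty$, one may take $\Delta=\infty$ (i.e. the inequalities hold for every $x\in\mathbb{R}^n$) and $v_\varepsilon(x)\leq\frac{\bar a_V}{a_W}c_{\text{stop}}(\varepsilon,x)$.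
   Context: System and costs. Consider $x^+=f(x,u)$ with $x\in\mathbb{R}^n$, $u\in\mathcal{U}(x)\subseteq\mathbb{R}^m$, $f:\mathcal{W}\to\mathbb{R}^n$, $\mathcal{W}:=\{(x,u):x\in\mathbb{R}^n,u\in\mathcal{U}(x)\}$, and a stage cost $\ell:\mathcal{W}\to\mathbb{R}_{\geq 0}$. For an input sequence $\mathbf{u}=[u_0,u_1,\dots]$, $\phi(k,x,\mathbf{u}|_k)$ is the state at time $k$ starting from $x$ under the first $k$ inputs $\mathbf{u}|_k=[u_0,\dots,u_{k-1}]$, with $\phi(0,x,\mathbf{u}|_0)=x$; $\mathbf{u}$ is admissible if $u_k\in\mathcal{U}(\phi(k,x,\mathbf{u}|_k))$ for all $k$. Define $J_\infty(x,\mathbf{u}):=\sum_{k=0}^\infty \ell(\phi(k,x,\mathbf{u}|_k),u_k)$ and, for $\mathbf{u}_d=[u_0,\dots,u_d]$, $J_d(x,\mathbf{u}_d):=\sum_{k=0}^d\ell(\phi(k,x,\mathbf{u}_d|_k),u_k)$. A function $\mathbb{R}_{\geq 0}\to\mathbb{R}_{\geq 0}$ is of class $\mathcal{K}_\infty$ if it is continuous, zero at zero, strictly increasing and unbounded. (A) There exist $\overline{\alpha}_V,\alpha_W\in\mathcal{K}_\infty$ and a continuous $\sigma:\mathbb{R}^n\to\mathbb{R}_{\geq 0}$ such that: (i) for any $x\in\mathbb{R}^n$ there is an admissible infinite input sequence $\mathbf{u}^*_\infty(x)$ minimizing $J_\infty(x,\cdot)$, and $V_\infty(x):=J_\infty(x,\mathbf{u}^*_\infty(x))\leq\overline{\alpha}_V(\sigma(x))$;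 (ii) $\alpha_W(\sigma(x))\leq\ell(x,u)$ for any $(x,u)\in\mathcal{W}$. (B) For every $d\in\mathbb{Z}_{\geq 0}$ and $x\in\mathbb{R}^n$, the minimum $V_d(x):=\min_{\mathbf{u}_d}J_d(x,\mathbf{u}_d)$ over admissible $\mathbf{u}_d$ exists. Also $V_{-1}:=0$. Value iteration started from $V_{-1}=0$, i.e. $V_d(x)=\min_{u\in\mathcal{U}(x)}\{\ell(x,u)+V_{d-1}(f(x,u))\}$, generates exactly these $V_d$. (C) Assumption on $c_{\text{stop}}$ ($n_\varepsilon\geq 1$): one of the following holds. (i) For any $\varepsilon\in\mathbb{R}^{n_\varepsilon}$ there is $\underline\epsilon>0$ such that, for any $x\in\mathbb{R}^n$, $c_{\text{stop}}(\varepsilon,x)\geq\underline\epsilon$. (ii) There exist $L,\bar a_V,a_W>0$ (with $L=\infty$ permitted) such that (A) holds with $\overline{\alpha}_V(s)\leq\bar a_V s$ and $\alpha_W(s)\geq a_W s$ for any $s\in[0,L]$ (any $s\geq 0$ if $L=\infty$); furthermore, for any $\varepsilon\in\mathbb{R}^{n_\varepsilon}$ there is $\underline\epsilon>0$ such that, for any $x\in\mathbb{R}^n$, $c_{\text{stop}}(\varepsilon,x)\geq\underline\epsilon\,\sigma(x)$. Stopped value function. $V_\varepsilon(x):=V_d(x)$, where $d\in\mathbb{Z}_{\geq 0}$ is an iteration at which the stopping criterion $V_d(x)-V_{d-1}(x)\leq c_{\text{stop}}(\varepsilon,x)$ holds (under (A), (B), (C) such a $d$ exists). *)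

theory Defs
  imports "HOL-Analysis.Analysis"
begin

definition class_K_inf :: "(real \<Rightarrow> real) \<Rightarrow> bool" where
  "class_K_inf a \<longleftrightarrow>
     continuous_on {0..} a \<and> a 0 = 0 \<and> strict_mono_on {0..} a \<and> \<not> bounded (a ` {0..})"

text \<open>The dynamics \<open>f\<close> and the stage cost \<open>l\<close> are total functions here, but they are only ever
  evaluated along admissible inputs, i.e. on pairs \<open>(x, u)\<close> with \<open>u \<in> U x\<close>. In \<open>phi f x us\<close> the
  time index is the length of the input list \<open>us\<close>.\<close>

definition phi :: "('x \<Rightarrow> 'u \<Rightarrow> 'x) \<Rightarrow> 'x \<Rightarrow> 'u list \<Rightarrow> 'x" where
  "phi f x us = foldl f x us"

definition admissible :: "('x \<Rightarrow> 'u \<Rightarrow> 'x) \<Rightarrow> ('x \<Rightarrow> 'u set) \<Rightarrow> 'x \<Rightarrow> (nat \<Rightarrow> 'u) \<Rightarrow> bool" where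
  "admissible f U x u \<longleftrightarrow> (\<forall>k. u k \<in> U (phi f x (map u [0..<k])))"

text \<open>Horizon \<open>d\<close> means \<open>d + 1\<close> inputs \<open>u\<^sub>0, \<dots>, u\<^sub>d\<close>.\<close>

definition admissible_fin ::
    "('x \<Rightarrow> 'u \<Rightarrow> 'x) \<Rightarrow> ('x \<Rightarrow> 'u set) \<Rightarrow> nat \<Rightarrow> 'x \<Rightarrow> 'u list \<Rightarrow> bool" where
  "admissible_fin f U d x us \<longleftrightarrow>
     length us = Suc d \<and> (\<forall>k\<le>d. us ! k \<in> U (phi f x (take k us)))"

definition J_inf :: "('x \<Rightarrow> 'u \<Rightarrow> 'x) \<Rightarrow> ('x \<Rightarrow> 'u \<Rightarrow> real) \<Rightarrow> 'x \<Rightarrow> (nat \<Rightarrow> 'u) \<Rightarrow> ereal" where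
  "J_inf f l x u = (\<Sum>k. ereal (l (phi f x (map u [0..<k])) (u k)))"

definition J_fin ::
    "('x \<Rightarrow> 'u \<Rightarrow> 'x) \<Rightarrow> ('x \<Rightarrow> 'u \<Rightarrow> real) \<Rightarrow> nat \<Rightarrow> 'x \<Rightarrow> 'u list \<Rightarrow> real" where
  "J_fin f l d x us = (\<Sum>k\<le>d. l (phi f x (take k us)) (us ! k))"

text \<open>The optimal values are the costs at an arbitrary minimizer; that minimizers exist is part of
  the assumptions below.\<close>

definition V_inf ::
    "('x \<Rightarrow> 'u \<Rightarrow> 'x) \<Rightarrow> ('x \<Rightarrow> 'u set) \<Rightarrow> ('x \<Rightarrow> 'u \<Rightarrow> real) \<Rightarrow> 'x \<Rightarrow> ereal" where
  "V_inf f U l x = J_inf f l x (arg_min (J_inf f l x) (admissible f U x))"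

definition V_fin ::
    "('x \<Rightarrow> 'u \<Rightarrow> 'x) \<Rightarrow> ('x \<Rightarrow> 'u set) \<Rightarrow> ('x \<Rightarrow> 'u \<Rightarrow> real) \<Rightarrow> nat \<Rightarrow> 'x \<Rightarrow> real" where
  "V_fin f U l d x = J_fin f l d x (arg_min (J_fin f l d x) (admissible_fin f U d x))"

text \<open>\<open>V_iter\<close> extends the indexing by \<open>V\<^bsub>-1\<^esub> = 0\<close>.\<close>

definition V_iter ::
    "('x \<Rightarrow> 'u \<Rightarrow> 'x) \<Rightarrow> ('x \<Rightarrow> 'u set) \<Rightarrow> ('x \<Rightarrow> 'u \<Rightarrow> real) \<Rightarrow> int \<Rightarrow> 'x \<Rightarrow> real" where
  "V_iter f U l d x = (if d < 0 then 0 else V_fin f U l (nat d) x)"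

definition assumption_A ::
    "('x::topological_space \<Rightarrow> 'u \<Rightarrow> 'x) \<Rightarrow> ('x \<Rightarrow> 'u set) \<Rightarrow> ('x \<Rightarrow> 'u \<Rightarrow> real) \<Rightarrow>
     (real \<Rightarrow> real) \<Rightarrow> (real \<Rightarrow> real) \<Rightarrow> ('x \<Rightarrow> real) \<Rightarrow> bool" where
  "assumption_A f U l alpha_V alpha_W \<sigma> \<longleftrightarrow>
     class_K_inf alpha_V \<and> class_K_inf alpha_W \<and>
     continuous_on UNIV \<sigma> \<and> (\<forall>x. 0 \<le> \<sigma> x) \<and>
     (\<forall>x. (\<exists>u. is_arg_min (J_inf f l x) (admissible f U x) u) \<and>
          V_inf f U l x \<le> ereal (alpha_V (\<sigma> x))) \<and>
     (\<forall>x. \<forall>u\<in>U x. alpha_W (\<sigma> x) \<le> l x u)"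

definition assumption_B ::
    "('x \<Rightarrow> 'u \<Rightarrow> 'x) \<Rightarrow> ('x \<Rightarrow> 'u set) \<Rightarrow> ('x \<Rightarrow> 'u \<Rightarrow> real) \<Rightarrow> bool" where
  "assumption_B f U l \<longleftrightarrow>
     (\<forall>d x. \<exists>us. is_arg_min (J_fin f l d x) (admissible_fin f U d x) us)"

definition assumption_C_i :: "('e \<Rightarrow> 'x \<Rightarrow> real) \<Rightarrow> bool" where
  "assumption_C_i c_stop \<longleftrightarrow> (\<forall>\<epsilon>. \<exists>e>0. \<forall>x. e \<le> c_stop \<epsilon> x)"

text \<open>The linear bounds are imposed on the very functions \<open>alpha_V\<close>, \<open>alpha_W\<close>, \<open>\<sigma>\<close> for which
  \<open>assumption_A\<close> is supposed; \<open>L = \<infinity>\<close> is allowed.\<close>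

definition assumption_C_ii ::
    "('e \<Rightarrow> 'x \<Rightarrow> real) \<Rightarrow> (real \<Rightarrow> real) \<Rightarrow> (real \<Rightarrow> real) \<Rightarrow> ('x \<Rightarrow> real) \<Rightarrow>
     ereal \<Rightarrow> real \<Rightarrow> real \<Rightarrow> bool" where
  "assumption_C_ii c_stop alpha_V alpha_W \<sigma> L a_V a_W \<longleftrightarrow>
     0 < L \<and> 0 < a_V \<and> 0 < a_W \<and>
     (\<forall>s\<ge>0. ereal s \<le> L \<longrightarrow> alpha_V s \<le> a_V * s \<and> a_W * s \<le> alpha_W s) \<and>
     (\<forall>\<epsilon>. \<exists>e>0. \<forall>x. e * \<sigma> x \<le> c_stop \<epsilon> x)"

definition assumption_C ::
    "('e \<Rightarrow> 'x \<Rightarrow> real) \<Rightarrow> (real \<Rightarrow> real) \<Rightarrow> (real \<Rightarrow> real) \<Rightarrow> ('x \<Rightarrow> real) \<Rightarrow> bool" where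
  "assumption_C c_stop alpha_V alpha_W \<sigma> \<longleftrightarrow>
     assumption_C_i c_stop \<or>
     (\<exists>L a_V a_W. assumption_C_ii c_stop alpha_V alpha_W \<sigma> L a_V a_W)"

text \<open>All values \<open>V\<^sub>d x\<close> that value iteration may return at \<open>x\<close>: any iteration \<open>d\<close> at which the
  stopping criterion holds is allowed, not just the first one.\<close>

definition stopped_values ::
    "('x \<Rightarrow> 'u \<Rightarrow> 'x) \<Rightarrow> ('x \<Rightarrow> 'u set) \<Rightarrow> ('x \<Rightarrow> 'u \<Rightarrow> real) \<Rightarrow> ('e \<Rightarrow> 'x \<Rightarrow> real) \<Rightarrow>
     'e \<Rightarrow> 'x \<Rightarrow> real set" where
  "stopped_values f U l c_stop \<epsilon> x =
     {V_iter f U l d x |d. d \<ge> 0 \<and> V_iter f U l d x - V_iter f U l (d - 1) x \<le> c_stop \<epsilon> x}"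

definition v_eps ::
    "(real \<Rightarrow> real) \<Rightarrow> (real \<Rightarrow> real) \<Rightarrow> ('e \<Rightarrow> 'x \<Rightarrow> real) \<Rightarrow> 'e \<Rightarrow> 'x \<Rightarrow> real" where
  "v_eps alpha_V alpha_W c_stop \<epsilon> x = alpha_V (inv_into {0..} alpha_W (c_stop \<epsilon> x))"

end

theory Submission
  imports Defs
begin

text \<open>If \<open>us\<close> is optimal for horizon \<open>d\<close>, dropping its last input gives a competitor for
  horizon \<open>d - 1\<close>, so the last stage cost is at most \<open>V\<^sub>d x - V\<^bsub>d-1\<^esub> x\<close>. When the stopping
  criterion holds, the last state \<open>z\<close> therefore satisfies \<open>alpha_W (\<sigma> z) \<le> c_stop \<epsilon> x\<close>, and
  continuing optimally from \<open>z\<close> costs at most \<open>alpha_V (\<sigma> z) \<le> v_eps x\<close>. The criterion is met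
  eventually because \<open>V\<^sub>d x\<close> is nondecreasing in \<open>d\<close> and bounded by \<open>V_inf x < \<infinity>\<close>; only
  at \<open>\<sigma> x = 0\<close> can the threshold vanish, and there all \<open>V\<^sub>d x\<close> are \<open>0\<close>.\<close>

section \<open>Class K-infinity functions, their inverses, and chosen minimizers\<close>

lemma class_K_inf_mono:
  assumes "class_K_inf a" "0 \<le> s" "s \<le> t"
  shows "a s \<le> a t"
  using assms by (auto simp: class_K_inf_def strict_mono_on_leD)

lemma class_K_inf_nonneg:
  assumes "class_K_inf a" "0 \<le> s"
  shows "0 \<le> a s"
  using class_K_inf_mono[OF assms(1) _ assms(2)] assms(1) by (simp add: class_K_inf_def)

text \<open>Unboundedness gives a value above \<open>c\<close>, and the intermediate value theorem
  starts from \<open>a 0 = 0\<close>. This makes \<open>inv_into {0..} a\<close> a genuine right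
  inverse on the nonnegative reals.\<close>

lemma class_K_inf_surj:
  assumes a: "class_K_inf a" and c: "0 \<le> c"
  shows "c \<in> a ` {0..}"
proof -
  have "\<exists>t\<ge>0. c \<le> a t"
  proof (rule ccontr)
    assume "\<not> ?thesis"
    then have "norm (a t) \<le> c" if "t \<ge> 0" for t
      using class_K_inf_nonneg[OF a that] that by force
    then have "bounded (a ` {0..})"
      by (auto intro!: boundedI)
    with a show False
      by (simp add: class_K_inf_def)
  qed
  then obtain t where t: "t \<ge> 0" "c \<le> a t"
    by blast
  have "continuous_on {0..t} a"
    using a by (auto simp: class_K_inf_def intro: continuous_on_subset)
  then obtain s where "0 \<le> s" "a s = c"
    using IVT'[of a 0 c t] a c t by (auto simp: class_K_inf_def)
  then show ?thesis
    by force
qed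

lemma class_K_inf_inverse:
  assumes "class_K_inf a" "0 \<le> c"
  shows "0 \<le> inv_into {0..} a c" "a (inv_into {0..} a c) = c"
  using inv_into_into[OF class_K_inf_surj[OF assms]] f_inv_into_f[OF class_K_inf_surj[OF assms]]
  by auto

lemma class_K_inf_le_inverse:
  assumes a: "class_K_inf a" and "0 \<le> s" "a s \<le> c"
  shows "s \<le> inv_into {0..} a c"
proof (rule ccontr)
  have "0 \<le> c"
    using class_K_inf_nonneg[OF a \<open>0 \<le> s\<close>] \<open>a s \<le> c\<close> by linarith
  note inv = class_K_inf_inverse[OF a this]
  assume "\<not> ?thesis"
  then have "a (inv_into {0..} a c) < a s"
    using a inv(1) by (auto simp: class_K_inf_def intro: strict_mono_onD)
  with inv(2) \<open>a s \<le> c\<close> show False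
    by linarith
qed

lemma inverse_rate_bound:
  assumes K: "class_K_inf alpha_W"
    and C: "assumption_C_ii c_stop alpha_V alpha_W \<sigma> \<infinity> a_V a_W"
    and c: "0 \<le> c_stop \<epsilon> x"
  shows "v_eps alpha_V alpha_W c_stop \<epsilon> x \<le> a_V / a_W * c_stop \<epsilon> x"
proof -
  define s where "s = inv_into {0..} alpha_W (c_stop \<epsilon> x)"
  have s: "0 \<le> s" "alpha_W s = c_stop \<epsilon> x"
    using class_K_inf_inverse[OF K c] by (auto simp: s_def)
  \<comment> \<open>\<open>L = \<infinity>\<close> makes both linear bounds available at
    \<open>s\<close>, however large it is.\<close>
  have a: "0 < a_V" "0 < a_W" "alpha_V s \<le> a_V * s" "a_W * s \<le> c_stop \<epsilon> x"
    using C s by (auto simp: assumption_C_ii_def)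
  have "a_V * s = a_V / a_W * (a_W * s)"
    using a by simp
  also have "\<dots> \<le> a_V / a_W * c_stop \<epsilon> x"
    using a by (intro mult_left_mono) auto
  finally show ?thesis
    using a by (simp add: v_eps_def s_def)
qed

text \<open>\<open>arg_min\<close> is a Hilbert choice, so the existence of any minimizer passes to
  the chosen one; this turns \<open>V_inf\<close> and \<open>V_fin\<close> into actual
  minima.\<close>

lemma is_arg_min_arg_min:
  assumes "is_arg_min J P u"
  shows "is_arg_min J P (arg_min J P)"
  using assms unfolding arg_min_def by (rule someI)

section \<open>Concatenating a finite input list with an infinite input sequence\<close>

definition prepend :: "'u list \<Rightarrow> (nat \<Rightarrow> 'u) \<Rightarrow> nat \<Rightarrow> 'u" where
  "prepend us v k = (if k < length us then us ! k else v (k - length us))"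

text \<open>Truncated subtraction lets one formula cover both cases: up to \<open>length us\<close>
  the second summand is empty, beyond it \<open>take k us\<close> is all of
  \<open>us\<close>.\<close>

lemma map_prepend_upt:
  "map (prepend us v) [0..<k] = take k us @ map v [0..<k - length us]"
  by (rule nth_equalityI) (auto simp: prepend_def nth_append)

lemma phi_append: "phi f x (us @ vs) = phi f (phi f x us) vs"
  by (simp add: phi_def)

lemma admissible_prepend:
  assumes "\<And>k. k < length us \<Longrightarrow> us ! k \<in> U (phi f x (take k us))"
    and "admissible f U (phi f x us) v"
  shows "admissible f U x (prepend us v)"
  using assms by (auto simp: admissible_def map_prepend_upt phi_append prepend_def phi_def)

lemma J_inf_prepend_le:
  assumes us: "\<And>k. k < length us \<Longrightarrow> us ! k \<in> U (phi f x (take k us))"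
    and v: "admissible f U (phi f x us) v"
    and nonneg: "\<And>x u. u \<in> U x \<Longrightarrow> 0 \<le> l x u"
  shows "J_inf f l x (prepend us v) \<le>
    ereal (\<Sum>k<length us. l (phi f x (take k us)) (us ! k)) + J_inf f l (phi f x us) v"
proof -
  let ?n = "length us"
  let ?g = "\<lambda>k. ereal (l (phi f x (map (prepend us v) [0..<k])) (prepend us v k))"
  let ?h = "\<lambda>k. ereal (l (phi f (phi f x us) (map v [0..<k])) (v k))"
  have g0: "0 \<le> ?g k" for k
    using admissible_prepend[OF us v] nonneg by (simp add: admissible_def)
  have h0: "0 \<le> ?h k" for k
    using v nonneg by (simp add: admissible_def)
  have "sum ?g {..<N} \<le> (\<Sum>k<?n. ?g k) + (\<Sum>k. ?h k)" for N
  proof -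
    \<comment> \<open>Adding nonnegative terms makes the sum reach past the junction, where it can
      be split into head and tail.\<close>
    have "sum ?g {..<N} \<le> sum ?g {..<?n + N}"
      using g0 by (intro sum_mono2) auto
    also have "\<dots> = sum ?g {..<?n} + (\<Sum>k<N. ?g (?n + k))"
      by (induction N) (auto simp: add.assoc)
    also have "(\<Sum>k<N. ?g (?n + k)) = sum ?h {..<N}"
      by (simp add: map_prepend_upt phi_append prepend_def)
    also have "sum ?g {..<?n} + sum ?h {..<N} \<le> sum ?g {..<?n} + (\<Sum>k. ?h k)"
      using h0 by (intro add_left_mono sum_le_suminf summable_ereal_pos) auto
    finally show ?thesis .
  qed
  moreover have "(\<Sum>k<?n. ?g k) = ereal (\<Sum>k<?n. l (phi f x (take k us)) (us ! k))"
    by (simp add: map_prepend_upt prepend_def)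
  ultimately show ?thesis
    unfolding J_inf_def using g0 by (intro suminf_bound) auto
qed

section \<open>Value functions under (A) and (B): bounds and monotonicity\<close>

locale optimal_control =
  fixes f :: "'x::topological_space \<Rightarrow> 'u \<Rightarrow> 'x"
    and U :: "'x \<Rightarrow> 'u set"
    and l :: "'x \<Rightarrow> 'u \<Rightarrow> real"
    and alpha_V alpha_W :: "real \<Rightarrow> real"
    and \<sigma> :: "'x \<Rightarrow> real"
  assumes l_nonneg: "\<And>x u. u \<in> U x \<Longrightarrow> 0 \<le> l x u"
    and A: "assumption_A f U l alpha_V alpha_W \<sigma>"
    and B: "assumption_B f U l"
begin

lemma K_inf: "class_K_inf alpha_V" "class_K_inf alpha_W"
  and sigma_nonneg: "0 \<le> \<sigma> x"
  and V_inf_upper: "V_inf f U l x \<le> ereal (alpha_V (\<sigma> x))"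
  and stage_lower: "u \<in> U x \<Longrightarrow> alpha_W (\<sigma> x) \<le> l x u"
  using A by (auto simp: assumption_A_def)

lemma V_inf_attained:
  obtains u where "admissible f U x u" "J_inf f l x u = V_inf f U l x"
proof -
  obtain u where "is_arg_min (J_inf f l x) (admissible f U x) u"
    using A unfolding assumption_A_def by blast
  from is_arg_min_arg_min[OF this] that show thesis
    by (auto simp: V_inf_def is_arg_min_def)
qed

lemma V_inf_le:
  assumes "admissible f U x u"
  shows "V_inf f U l x \<le> J_inf f l x u"
proof -
  obtain v where "is_arg_min (J_inf f l x) (admissible f U x) v"
    using A unfolding assumption_A_def by blast
  from is_arg_min_arg_min[OF this] assms show ?thesis
    by (auto simp: V_inf_def is_arg_min_def not_less)
qed

lemma V_fin_attained:
  obtains us where "admissible_fin f U d x us" "J_fin f l d x us = V_fin f U l d x"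
proof -
  obtain us where "is_arg_min (J_fin f l d x) (admissible_fin f U d x) us"
    using B unfolding assumption_B_def by blast
  from is_arg_min_arg_min[OF this] that show thesis
    by (auto simp: V_fin_def is_arg_min_def)
qed

lemma V_fin_le:
  assumes "admissible_fin f U d x us"
  shows "V_fin f U l d x \<le> J_fin f l d x us"
proof -
  obtain vs where "is_arg_min (J_fin f l d x) (admissible_fin f U d x) vs"
    using B unfolding assumption_B_def by blast
  from is_arg_min_arg_min[OF this] assms show ?thesis
    by (auto simp: V_fin_def is_arg_min_def not_less)
qed

text \<open>The first \<open>d + 1\<close> inputs of an optimal infinite sequence compete for
  horizon \<open>d\<close>, and their cost is a partial sum of a nonnegative series.\<close>

lemma V_fin_le_V_inf: "ereal (V_fin f U l d x) \<le> V_inf f U l x"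
proof -
  obtain u where u: "admissible f U x u" "J_inf f l x u = V_inf f U l x"
    by (rule V_inf_attained)
  let ?us = "map u [0..<Suc d]"
  have take_us: "take k ?us = map u [0..<k]" if "k \<le> d" for k
    using that by (simp add: take_map del: upt_Suc)
  have nth_us: "?us ! k = u k" if "k \<le> d" for k
    using that by (simp add: nth_map_upt del: upt_Suc)
  have "admissible_fin f U d x ?us"
    using u(1) take_us nth_us by (simp add: admissible_fin_def admissible_def del: upt_Suc)
  from V_fin_le[OF this]
  have "ereal (V_fin f U l d x) \<le> (\<Sum>k\<le>d. ereal (l (phi f x (map u [0..<k])) (u k)))"
    by (simp add: J_fin_def take_us nth_us del: upt_Suc)
  also have "\<dots> \<le> J_inf f l x u"
    unfolding J_inf_def using u(1) l_nonneg
    by (intro sum_le_suminf summable_ereal_pos) (auto simp: admissible_def)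
  finally show ?thesis
    using u(2) by simp
qed

lemma last_stage_cost_le:
  assumes us: "admissible_fin f U d x us" "J_fin f l d x us = V_fin f U l d x"
  shows "l (phi f x (take d us)) (us ! d) \<le> V_iter f U l (int d) x - V_iter f U l (int d - 1) x"
proof (cases d)
  case 0
  \<comment> \<open>Here the predecessor is \<open>V_iter\<close> at index -1, which is 0, and the
    only stage cost is all of \<open>V_fin f U l 0 x\<close>.\<close>
  then show ?thesis
    using us by (simp add: V_iter_def J_fin_def)
next
  case (Suc e)
  \<comment> \<open>\<open>take d us\<close> has \<open>d = Suc e\<close> inputs, the right number
    for horizon \<open>e\<close>.\<close>
  have "admissible_fin f U e x (take d us)"
    using us(1) Suc by (auto simp: admissible_fin_def min_def)
  then have "V_fin f U l e x \<le> J_fin f l e x (take d us)"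
    by (rule V_fin_le)
  also have "\<dots> = (\<Sum>k\<le>e. l (phi f x (take k us)) (us ! k))"
    unfolding J_fin_def using Suc by (intro sum.cong) (auto simp: min_def)
  also have "\<dots> = V_fin f U l d x - l (phi f x (take d us)) (us ! d)"
    using us(2) Suc by (simp add: J_fin_def)
  finally show ?thesis
    using Suc by (simp add: V_iter_def nat_add_distrib)
qed

lemma V_iter_mono_step: "V_iter f U l (int d - 1) x \<le> V_iter f U l (int d) x"
proof -
  obtain us where us: "admissible_fin f U d x us" "J_fin f l d x us = V_fin f U l d x"
    by (rule V_fin_attained)
  have "0 \<le> l (phi f x (take d us)) (us ! d)"
    using us(1) by (auto simp: admissible_fin_def intro: l_nonneg)
  with last_stage_cost_le[OF us] show ?thesis
    by linarith
qed

lemma V_fin_le_alpha_V: "V_fin f U l d x \<le> alpha_V (\<sigma> x)"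
  using order_trans[OF V_fin_le_V_inf V_inf_upper] by simp

section \<open>Error bound at a stopping iteration\<close>

lemma V_inf_le_stopped:
  assumes stop: "V_iter f U l (int d) x - V_iter f U l (int d - 1) x \<le> c"
  shows "V_inf f U l x \<le> ereal (V_fin f U l d x + alpha_V (inv_into {0..} alpha_W c))"
proof -
  obtain us where us: "admissible_fin f U d x us" "J_fin f l d x us = V_fin f U l d x"
    by (rule V_fin_attained)
  let ?ps = "take d us"
  \<comment> \<open>The state in which the last input is applied, not the one it leads to, so that
    the last stage cost controls \<open>\<sigma> z\<close>.\<close>
  define z where "z = phi f x ?ps"
  have len: "length ?ps = d"
    using us(1) by (simp add: admissible_fin_def)
  have last: "us ! d \<in> U z"
    using us(1) by (simp add: admissible_fin_def z_def)
  have "alpha_W (\<sigma> z) \<le> c"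
    using stage_lower[OF last] last_stage_cost_le[OF us] stop by (simp add: z_def)
  then have "\<sigma> z \<le> inv_into {0..} alpha_W c"
    by (rule class_K_inf_le_inverse[OF K_inf(2) sigma_nonneg])
  then have tail: "alpha_V (\<sigma> z) \<le> alpha_V (inv_into {0..} alpha_W c)"
    by (rule class_K_inf_mono[OF K_inf(1) sigma_nonneg])
  have ps: "?ps ! k \<in> U (phi f x (take k ?ps))" if "k < length ?ps" for k
    using us(1) that len by (simp add: admissible_fin_def min_def)
  have "(\<Sum>k<length ?ps. l (phi f x (take k ?ps)) (?ps ! k))
      = (\<Sum>k<d. l (phi f x (take k us)) (us ! k))"
    unfolding len by (intro sum.cong) (auto simp: min_def)
  \<comment> \<open>The last input is replaced by an optimal continuation from \<open>z\<close>, so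
    its cost leaves the head.\<close>
  also have "\<dots> = V_fin f U l d x - l z (us ! d)"
    using us(2) by (simp add: J_fin_def z_def lessThan_Suc_atMost[symmetric])
  also have "\<dots> \<le> V_fin f U l d x"
    using l_nonneg[OF last] by simp
  finally have head: "(\<Sum>k<length ?ps. l (phi f x (take k ?ps)) (?ps ! k)) \<le> V_fin f U l d x" .
  obtain v where v: "admissible f U z v" "J_inf f l z v = V_inf f U l z"
    by (rule V_inf_attained)
  have "V_inf f U l x \<le> J_inf f l x (prepend ?ps v)"
    using ps v(1) unfolding z_def by (intro V_inf_le admissible_prepend) auto
  also have "\<dots> \<le> ereal (\<Sum>k<length ?ps. l (phi f x (take k ?ps)) (?ps ! k)) + J_inf f l z v"
    unfolding z_def by (rule J_inf_prepend_le[OF ps v(1)[unfolded z_def] l_nonneg])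
  also have "\<dots> \<le> ereal (V_fin f U l d x) + ereal (alpha_V (\<sigma> z))"
    unfolding v(2) using head V_inf_upper by (intro add_mono) auto
  also have "\<dots> \<le> ereal (V_fin f U l d x + alpha_V (inv_into {0..} alpha_W c))"
    using tail by simp
  finally show ?thesis .
qed

section \<open>Existence of a stopping iteration\<close>

lemma V_fin_increments_tendsto_0: "(\<lambda>d. V_fin f U l (Suc d) x - V_fin f U l d x) \<longlonglongrightarrow> 0"
proof -
  \<comment> \<open>Monotone and bounded by \<open>alpha_V (\<sigma> x)\<close>, the values
    converge, so their increments vanish. Instantiating at \<open>Suc d\<close> keeps clear of index
    -1.\<close>
  have "incseq (\<lambda>d. V_fin f U l d x)"
    using V_iter_mono_step[of "Suc d" x for d] by (intro incseq_SucI) (simp add: V_iter_def nat_add_distrib)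
  then obtain L where L: "(\<lambda>d. V_fin f U l d x) \<longlonglongrightarrow> L"
    using incseq_convergent V_fin_le_alpha_V by metis
  from tendsto_diff[OF LIMSEQ_Suc[OF L] L] show ?thesis
    by simp
qed

text \<open>The hypothesis is what both alternatives of (C) yield for
  \<open>c = c_stop \<epsilon> x\<close>: a positive threshold, or a nonnegative one at a zero of
  \<open>\<sigma>\<close>.\<close>

lemma stopping_eventually:
  assumes "0 < c \<or> 0 \<le> c \<and> \<sigma> x = 0"
  shows "\<exists>d. V_iter f U l (int d) x - V_iter f U l (int d - 1) x \<le> c"
proof (cases "0 < c")
  case True
  from order_tendstoD(2)[OF V_fin_increments_tendsto_0 this]
  obtain d where "V_fin f U l (Suc d) x - V_fin f U l d x < c"
    by (auto simp: eventually_sequentially)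
  then show ?thesis
    by (intro exI[of _ "Suc d"]) (simp add: V_iter_def nat_add_distrib)
next
  case False
  with assms have "0 \<le> c" "\<sigma> x = 0"
    by auto
  \<comment> \<open>\<open>alpha_V (\<sigma> x) = alpha_V 0 = 0\<close>, so the criterion already
    holds at iteration 0.\<close>
  then have "V_fin f U l 0 x \<le> c"
    using V_fin_le_alpha_V[of 0 x] K_inf(1) by (simp add: class_K_inf_def)
  then show ?thesis
    by (intro exI[of _ 0]) (simp add: V_iter_def)
qed

text \<open>Passes to natural iteration numbers while still subtracting in the integers: at
  \<open>d = 0\<close> the predecessor must be index -1, whereas truncated subtraction would give
  0.\<close>

lemma stopped_values_eq:
  "stopped_values f U l c_stop \<epsilon> x =
    {V_fin f U l d x |d. V_iter f U l (int d) x - V_iter f U l (int d - 1) x \<le> c_stop \<epsilon> x}"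
  unfolding stopped_values_def
proof (intro Collect_cong iffI; elim exE conjE)
  fix v d assume "v = V_iter f U l d x" "0 \<le> d"
    "V_iter f U l d x - V_iter f U l (d - 1) x \<le> c_stop \<epsilon> x"
  then show "\<exists>d. v = V_fin f U l d x \<and>
      V_iter f U l (int d) x - V_iter f U l (int d - 1) x \<le> c_stop \<epsilon> x"
    by (intro exI[of _ "nat d"]) (auto simp: V_iter_def)
next
  fix v d assume "v = V_fin f U l d x"
    "V_iter f U l (int d) x - V_iter f U l (int d - 1) x \<le> c_stop \<epsilon> x"
  then show "\<exists>d. v = V_iter f U l d x \<and> 0 \<le> d \<and>
      V_iter f U l d x - V_iter f U l (d - 1) x \<le> c_stop \<epsilon> x"
    by (intro exI[of _ "int d"]) (auto simp: V_iter_def)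
qed

lemma stopped_values_nonempty:
  assumes c: "\<And>\<epsilon> x. 0 \<le> c_stop \<epsilon> x" and C: "assumption_C c_stop alpha_V alpha_W \<sigma>"
  shows "stopped_values f U l c_stop \<epsilon> x \<noteq> {}"
proof -
  have "0 < c_stop \<epsilon> x \<or> 0 \<le> c_stop \<epsilon> x \<and> \<sigma> x = 0"
    using C unfolding assumption_C_def
  proof (elim disjE exE)
    assume "assumption_C_i c_stop"
    then show ?thesis
      unfolding assumption_C_i_def by (metis less_le_trans)
  next
    fix L a_V a_W assume "assumption_C_ii c_stop alpha_V alpha_W \<sigma> L a_V a_W"
    then obtain e where "0 < e" "e * \<sigma> x \<le> c_stop \<epsilon> x"
      unfolding assumption_C_ii_def by blast
    then show ?thesis
      \<comment> \<open>Either \<open>\<sigma> x = 0\<close>, or \<open>e * \<sigma> x\<close> is a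
        positive lower bound of the threshold.\<close>
      using sigma_nonneg[of x] c by (metis less_le less_le_trans mult_pos_pos)
  qed
  from stopping_eventually[OF this] show ?thesis
    unfolding stopped_values_eq by blast
qed

lemma stopped_values_bounds:
  assumes "V \<in> stopped_values f U l c_stop \<epsilon> x"
  shows "ereal V \<le> V_inf f U l x"
    and "V_inf f U l x \<le> ereal (V + v_eps alpha_V alpha_W c_stop \<epsilon> x)"
  using assms V_fin_le_V_inf V_inf_le_stopped by (auto simp: stopped_values_eq v_eps_def)

end

text \<open>Nonemptiness of \<open>stopped_values\<close> accompanies the bounds because these range
  over all its members and would be vacuous on an empty set.\<close>

theorem theorem3:
  fixes f :: "real ^ 'n \<Rightarrow> real ^ 'm \<Rightarrow> real ^ 'n"
    and U :: "real ^ 'n \<Rightarrow> (real ^ 'm) set"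
    and l :: "real ^ 'n \<Rightarrow> real ^ 'm \<Rightarrow> real"
    and alpha_V alpha_W :: "real \<Rightarrow> real"
    and \<sigma> :: "real ^ 'n \<Rightarrow> real"
    and c_stop :: "real ^ 'e \<Rightarrow> real ^ 'n \<Rightarrow> real"
  assumes l_nonneg: "\<And>x u. u \<in> U x \<Longrightarrow> 0 \<le> l x u"
    and c_stop_nonneg: "\<And>\<epsilon> x. 0 \<le> c_stop \<epsilon> x"
    and A: "assumption_A f U l alpha_V alpha_W \<sigma>"
    and B: "assumption_B f U l"
    and C: "assumption_C c_stop alpha_V alpha_W \<sigma>"
  shows "(\<forall>\<epsilon> \<Delta> x. 0 < \<Delta> \<and> x \<in> {z. \<sigma> z \<le> \<Delta>} \<longrightarrow>
            stopped_values f U l c_stop \<epsilon> x \<noteq> {} \<and>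
            (\<forall>V_eps \<in> stopped_values f U l c_stop \<epsilon> x.
               ereal V_eps \<le> V_inf f U l x \<and>
               V_inf f U l x \<le> ereal (V_eps + v_eps alpha_V alpha_W c_stop \<epsilon> x))) \<and>
         (\<forall>a_V a_W. assumption_C_ii c_stop alpha_V alpha_W \<sigma> \<infinity> a_V a_W \<longrightarrow>
            (\<forall>\<epsilon> x.
               stopped_values f U l c_stop \<epsilon> x \<noteq> {} \<and>
               (\<forall>V_eps \<in> stopped_values f U l c_stop \<epsilon> x.
                  ereal V_eps \<le> V_inf f U l x \<and>
                  V_inf f U l x \<le> ereal (V_eps + v_eps alpha_V alpha_W c_stop \<epsilon> x)) \<and>
               v_eps alpha_V alpha_W c_stop \<epsilon> x \<le> a_V / a_W * c_stop \<epsilon> x))"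
proof -
  interpret optimal_control f U l alpha_V alpha_W \<sigma>
    using l_nonneg A B by unfold_locales
  have "v_eps alpha_V alpha_W c_stop \<epsilon> x \<le> a_V / a_W * c_stop \<epsilon> x"
    if "assumption_C_ii c_stop alpha_V alpha_W \<sigma> \<infinity> a_V a_W" for a_V a_W \<epsilon> x
    using K_inf(2) that c_stop_nonneg by (rule inverse_rate_bound)
  then show ?thesis
    by (intro conjI allI impI ballI stopped_values_nonempty[OF c_stop_nonneg C]
        stopped_values_bounds)
qed

end
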